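(* Let $E$ be a Banach lattice, and let $T:E\to E$ be a u$\sigma$o-continuous operator. If $T^2$ is uo-demi Dunford–Pettis, then $T$ is uo-demi Dunford–Pettis.
   Context: All Banach lattices are real; "operator" means bounded linear map. A net $(x_\alpha)$ in a Banach lattice $E$ is uo-convergent (unbounded order convergent) to $x$, written $x_\alpha\xrightarrow{uo}x$, if $|x_\alpha-x|\wedge y$ converges in order to $0$ for every $y\in E^+$. An operator $T:E\to E$ on a Banach lattice $E$ is uo-demi Dunford–Pettis (unbounded order demi Dunford–Pettis) if for every weakly null sequence $(x_n)$ in $E$ such that $(x_n-T(x_n))$ is uo-convergent to $0$, one has $\|x_n\|\to0$. An operator $T:E\to E$ is u$\sigma$o-continuous (unbounded $\sigma$-order continuous) if for every sequence $(x_n)$ in $E$, $x_n\xrightarrow{uo}0$ implies $T(x_n)\xrightarrow{uo}0$. *)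

theory Defs
  imports
    "HOL-Analysis.Analysis"
    "HOL-Library.Lattice_Algebras"
    "HOL-Library.Lub_Glb"
begin

class banach_lattice = banach + ordered_real_vector + lattice_ab_group_add_abs +
  assumes norm_mono_abs: "\<bar>x\<bar> \<le> \<bar>y\<bar> \<Longrightarrow> norm x \<le> norm y"

instance real :: banach_lattice
proof
  fix x y :: real
  show "\<bar>x\<bar> \<le> \<bar>y\<bar> \<Longrightarrow> norm x \<le> norm y" unfolding real_norm_def .
qed

text \<open>
  Order convergence in the sense of the literature on unbounded order convergence: there is a
  net decreasing to 0, possibly over another index set than that of \<open>f\<close>, each member of which
  eventually dominates \<open>\<bar>f - x\<bar>\<close>.  In particular the dominating net is not required to be a
  sequence when \<open>f\<close> is one.
  Only the range of the dominating net matters, so it is given as a downward directed set \<open>D\<close>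
  with infimum 0, that is, as a net indexed by itself; \<open>order_convergesI_net\<close> below shows that
  arbitrary index types give nothing more.  Convergence of a net \<open>f\<close> is expressed with the filter
  \<open>F\<close> generated by the tails of its index set, which is \<open>sequentially\<close> for sequences.
\<close>

definition order_converges :: "('i \<Rightarrow> 'a::banach_lattice) \<Rightarrow> 'a \<Rightarrow> 'i filter \<Rightarrow> bool" where
  "order_converges f x F \<longleftrightarrow>
    (\<exists>D. D \<noteq> {} \<and> (\<forall>a\<in>D. \<forall>b\<in>D. \<exists>c\<in>D. c \<le> a \<and> c \<le> b) \<and> isGlb UNIV D 0 \<and>
      (\<forall>d\<in>D. eventually (\<lambda>i. \<bar>f i - x\<bar> \<le> d) F))"

lemma order_convergesI_net:
  fixes f :: "'i \<Rightarrow> 'a::banach_lattice" and I :: "'j set" and le :: "'j \<Rightarrow> 'j \<Rightarrow> bool"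
  assumes "I \<noteq> {}"
    and directed: "\<And>i j. i \<in> I \<Longrightarrow> j \<in> I \<Longrightarrow> \<exists>k\<in>I. le i k \<and> le j k"
    and decreasing: "\<And>i j. i \<in> I \<Longrightarrow> j \<in> I \<Longrightarrow> le i j \<Longrightarrow> y j \<le> y i"
    and "isGlb UNIV (y ` I) 0"
    and "\<And>j. j \<in> I \<Longrightarrow> eventually (\<lambda>i. \<bar>f i - x\<bar> \<le> y j) F"
  shows "order_converges f x F"
  unfolding order_converges_def
proof (intro exI[of _ "y ` I"] conjI)
  show "\<forall>a\<in>y ` I. \<forall>b\<in>y ` I. \<exists>c\<in>y ` I. c \<le> a \<and> c \<le> b"
  proof (intro ballI)
    fix a b assume "a \<in> y ` I" "b \<in> y ` I"
    then obtain i j where ij: "i \<in> I" "j \<in> I" "a = y i" "b = y j" by blast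
    with directed obtain k where k: "k \<in> I" "le i k" "le j k" by blast
    have "y k \<le> a" "y k \<le> b"
      unfolding ij using decreasing ij k by blast+
    with k(1) show "\<exists>c\<in>y ` I. c \<le> a \<and> c \<le> b" by blast
  qed
qed (use assms(1,4,5) in blast)+

definition uo_converges :: "('i \<Rightarrow> 'a::banach_lattice) \<Rightarrow> 'a \<Rightarrow> 'i filter \<Rightarrow> bool" where
  "uo_converges f x F \<longleftrightarrow> (\<forall>y\<ge>0. order_converges (\<lambda>i. inf \<bar>f i - x\<bar> y) 0 F)"

definition weakly_null :: "(nat \<Rightarrow> 'a::real_normed_vector) \<Rightarrow> bool" where
  "weakly_null x \<longleftrightarrow> (\<forall>\<phi>::'a \<Rightarrow> real. bounded_linear \<phi> \<longrightarrow> (\<lambda>n. \<phi> (x n)) \<longlonglongrightarrow> 0)"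

definition uo_demi_dunford_pettis :: "('a::banach_lattice \<Rightarrow> 'a) \<Rightarrow> bool" where
  "uo_demi_dunford_pettis T \<longleftrightarrow> bounded_linear T \<and>
    (\<forall>x. weakly_null x \<longrightarrow> uo_converges (\<lambda>n. x n - T (x n)) 0 sequentially \<longrightarrow>
      (\<lambda>n. norm (x n)) \<longlonglongrightarrow> 0)"

definition u_sigma_o_continuous :: "('a::banach_lattice \<Rightarrow> 'a) \<Rightarrow> bool" where
  "u_sigma_o_continuous T \<longleftrightarrow> bounded_linear T \<and>
    (\<forall>x. uo_converges x 0 sequentially \<longrightarrow> uo_converges (\<lambda>n. T (x n)) 0 sequentially)"

end

theory Submission
  imports Defs
begin

text \<open>
  The identity \<open>x - T (T x) = (x - T x) + T (x - T x)\<close> exhibits \<open>x\<^sub>n - T\<^sup>2 x\<^sub>n\<close> as a sum of two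
  uo-null sequences whenever \<open>x\<^sub>n - T x\<^sub>n\<close> is uo-null and \<open>T\<close> preserves uo-null sequences.
\<close>

lemma isGlb_UNIV_iff:
  "isGlb UNIV D (l::'a::order) \<longleftrightarrow> (\<forall>d\<in>D. l \<le> d) \<and> (\<forall>b. (\<forall>d\<in>D. b \<le> d) \<longrightarrow> b \<le> l)"
  by (auto simp: isGlb_def isLb_def greatestP_def setge_def setle_def)

text \<open>The sums \<open>a + b\<close> of members of the two dominating sets form a dominating
  set for the sum: common lower bounds are found in each summand, the infimum 0 survives the
  addition, and the triangle inequality gives the eventual bound.\<close>

lemma order_converges_add:
  assumes "order_converges f x F" and "order_converges g y F"
  shows "order_converges (\<lambda>i. f i + g i) (x + y) F"
proof -
  obtain A where A: "A \<noteq> {}" "\<forall>a\<in>A. \<forall>b\<in>A. \<exists>c\<in>A. c \<le> a \<and> c \<le> b" "isGlb UNIV A 0"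
    "\<forall>d\<in>A. eventually (\<lambda>i. \<bar>f i - x\<bar> \<le> d) F"
    using assms(1) unfolding order_converges_def by blast
  obtain B where B: "B \<noteq> {}" "\<forall>a\<in>B. \<forall>b\<in>B. \<exists>c\<in>B. c \<le> a \<and> c \<le> b" "isGlb UNIV B 0"
    "\<forall>d\<in>B. eventually (\<lambda>i. \<bar>g i - y\<bar> \<le> d) F"
    using assms(2) unfolding order_converges_def by blast
  define D where "D = {a + b |a b. a \<in> A \<and> b \<in> B}"
  have "\<exists>c\<in>D. c \<le> d \<and> c \<le> e" if de: "d \<in> D" "e \<in> D" for d e
  proof -
    obtain a b a' b' where ab: "d = a + b" "e = a' + b'" "a \<in> A" "a' \<in> A" "b \<in> B" "b' \<in> B"
      using de unfolding D_def by blast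
    obtain p q where "p \<in> A" "p \<le> a" "p \<le> a'" "q \<in> B" "q \<le> b" "q \<le> b'"
      using A(2) B(2) ab by meson
    then show ?thesis
      unfolding ab D_def by (intro bexI[of _ "p + q"]) (auto intro: add_mono)
  qed
  moreover have "isGlb UNIV D 0"
    unfolding isGlb_UNIV_iff
  proof (intro conjI ballI allI impI)
    fix d assume "d \<in> D"
    then show "0 \<le> d"
      using A(3) B(3) unfolding D_def isGlb_UNIV_iff by auto
  next
    fix l assume l: "\<forall>d\<in>D. l \<le> d"
    have "l \<le> b" if b: "b \<in> B" for b
    proof -
      \<comment> \<open>The two infima are taken one after the other: with \<open>b\<close> fixed,
        \<open>l - b\<close> bounds \<open>A\<close> from below, so \<open>l \<le> b\<close>;
        letting \<open>b\<close> vary then makes \<open>l\<close> a lower bound of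
        \<open>B\<close>.\<close>
      have "\<forall>a\<in>A. l - b \<le> a"
        using l b unfolding D_def by (auto simp: diff_le_eq)
      then have "l - b \<le> 0"
        using A(3) unfolding isGlb_UNIV_iff by blast
      then show ?thesis by simp
    qed
    then show "l \<le> 0"
      using B(3) unfolding isGlb_UNIV_iff by blast
  qed
  moreover have "eventually (\<lambda>i. \<bar>f i + g i - (x + y)\<bar> \<le> d) F" if d: "d \<in> D" for d
  proof -
    obtain a b where ab: "d = a + b" "a \<in> A" "b \<in> B"
      using d unfolding D_def by blast
    have "eventually (\<lambda>i. \<bar>f i - x\<bar> \<le> a) F" "eventually (\<lambda>i. \<bar>g i - y\<bar> \<le> b) F"
      using A(4) B(4) ab by blast+
    then show ?thesis
    proof eventually_elim
      case (elim i)
      have "\<bar>(f i - x) + (g i - y)\<bar> \<le> \<bar>f i - x\<bar> + \<bar>g i - y\<bar>"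
        by (rule abs_triangle_ineq)
      also have "\<dots> \<le> a + b" using elim by (rule add_mono)
      finally show ?case by (simp add: ab add_diff_add)
    qed
  qed
  moreover have "D \<noteq> {}" using A(1) B(1) unfolding D_def by blast
  ultimately show ?thesis unfolding order_converges_def by blast
qed

text \<open>Any set that dominates \<open>g\<close> dominates \<open>f\<close> as well, so the same
  \<open>D\<close> serves as witness.\<close>

lemma order_converges_0_mono:
  assumes "order_converges g 0 F" and "\<And>i. \<bar>f i\<bar> \<le> \<bar>g i\<bar>"
  shows "order_converges f 0 F"
proof -
  have "eventually (\<lambda>i. \<bar>f i - 0\<bar> \<le> d) F" if "eventually (\<lambda>i. \<bar>g i - 0\<bar> \<le> d) F" for d
    using that
  proof eventually_elim
    case (elim i)
    with assms(2)[of i] show ?case by simp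
  qed
  then show ?thesis
    using assms(1) unfolding order_converges_def by blast
qed

text \<open>Addition distributes over \<open>inf\<close>, so the right-hand side is the infimum of
  \<open>a + b\<close>, \<open>a + y\<close>, \<open>y + b\<close> and \<open>y + y\<close>. The
  first bounds the left-hand side trivially; the other three lie above \<open>y\<close> by
  positivity.\<close>

lemma inf_add_le_add_inf:
  fixes a b y :: "'a::lattice_ab_group_add"
  assumes "0 \<le> a" "0 \<le> b" "0 \<le> y"
  shows "inf (a + b) y \<le> inf a y + inf b y"
proof -
  have "inf (a + b) y \<le> a + b" "inf (a + b) y \<le> y"
    by simp_all
  moreover from this assms have
    "inf (a + b) y \<le> a + y" "inf (a + b) y \<le> y + b" "inf (a + b) y \<le> y + y"
    by (meson add_increasing add_increasing2 order_trans)+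
  ultimately show ?thesis
    by (simp only: add_inf_distrib_left add_inf_distrib_right le_inf_iff simp_thms)
qed

text \<open>Truncation by a fixed \<open>y \<ge> 0\<close> is subadditive on positive elements,
  which reduces the claim to order convergence of the sum of the two truncated nets.\<close>

lemma uo_converges_0_add:
  fixes f g :: "'i \<Rightarrow> 'a::banach_lattice"
  assumes "uo_converges f 0 F" and "uo_converges g 0 F"
  shows "uo_converges (\<lambda>i. f i + g i) 0 F"
  unfolding uo_converges_def
proof (intro allI impI)
  fix y :: 'a assume y: "0 \<le> y"
  have "order_converges (\<lambda>i. inf \<bar>f i\<bar> y + inf \<bar>g i\<bar> y) 0 F"
    using order_converges_add[of "\<lambda>i. inf \<bar>f i\<bar> y" 0 F "\<lambda>i. inf \<bar>g i\<bar> y" 0] assms y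
    unfolding uo_converges_def by simp
  \<comment> \<open>Both truncations are nonnegative, so the outer absolute values, present only to
    match \<open>order_converges_0_mono\<close>, drop out.\<close>
  moreover have "\<bar>inf \<bar>f i + g i\<bar> y\<bar> \<le> \<bar>inf \<bar>f i\<bar> y + inf \<bar>g i\<bar> y\<bar>" for i
  proof -
    have "inf \<bar>f i + g i\<bar> y \<le> inf (\<bar>f i\<bar> + \<bar>g i\<bar>) y"
      by (intro inf_mono abs_triangle_ineq order_refl)
    also have "\<dots> \<le> inf \<bar>f i\<bar> y + inf \<bar>g i\<bar> y"
      by (intro inf_add_le_add_inf abs_ge_zero y)
    finally show ?thesis using y by simp
  qed
  ultimately show "order_converges (\<lambda>i. inf \<bar>f i + g i - 0\<bar> y) 0 F"
    by (simp add: order_converges_0_mono)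
qed

theorem proposition5p1:
  fixes T :: "'a::banach_lattice \<Rightarrow> 'a"
  assumes "bounded_linear T"
    and "u_sigma_o_continuous T"
    and "uo_demi_dunford_pettis (T ^^ 2)"
  shows "uo_demi_dunford_pettis T"
  unfolding uo_demi_dunford_pettis_def
proof (intro conjI allI impI)
  fix x :: "nat \<Rightarrow> 'a"
  assume x: "weakly_null x" and uo: "uo_converges (\<lambda>n. x n - T (x n)) 0 sequentially"
  interpret bounded_linear T by fact
  \<comment> \<open>Continuity is applied to the differences \<open>x n - T (x n)\<close>, since
    these, rather than the \<open>x n\<close> themselves, are known to be uo-null.\<close>
  have "uo_converges (\<lambda>n. T (x n - T (x n))) 0 sequentially"
    using assms(2) uo unfolding u_sigma_o_continuous_def by blast
  from uo_converges_0_add[OF uo this]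
  have "uo_converges (\<lambda>n. x n - (T ^^ 2) (x n)) 0 sequentially"
    \<comment> \<open>Linearity splits \<open>T (x n - T (x n))\<close>, and the two copies of
      \<open>T (x n)\<close> cancel in the sum.\<close>
    by (simp add: diff numeral_2_eq_2)
  with assms(3) x show "(\<lambda>n. norm (x n)) \<longlonglongrightarrow> 0"
    unfolding uo_demi_dunford_pettis_def by blast
qed (fact assms(1))

end
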